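(* (Preservation for the Space-Efficient Parameterized Cast Calculus.) Fix any ComposableCasts structure. For all contexts $\Gamma$, types $A$, and terms $M,M'$ of $SC(\Rightarrow)$: if $M:\Gamma\vdash A$ and $ctx\vdash M\longrightarrow M'$ for some $ctx\in\{\mathtt{Any},\mathtt{NonCast}\}$, then $M':\Gamma\vdash A$.
   Context: **Types.** Base types $b$: $\mathtt{Nat},\mathtt{Bool},\mathtt{Int},\mathtt{Unit},\bot$. Types: $A,B::=b\mid\,?\mid A\to B\mid A\times B\mid A+B$. Contexts $\Gamma$ are finite sequences of types; variables are de Bruijn indices (index $0$ is the last-added type). Primitive types $P::=b\mid b\to P$; each $b$ denotes a set (naturals, Booleans, integers, one-element set, empty set) and $[\![b\to P]\!]$ is the set of functions $[\![b]\!]\to[\![P]\!]$. Blame labels $\ell$ range over a fixed set. **PreCastStruct**: for all types $A,B$ a set $A\Rightarrow B$ of casts; predicates $\mathsf{Inert}$, $\mathsf{Active}$, $\mathsf{Cross}$ on casts; every cast is active or inert; every inert cast $c:A\Rightarrow(B\otimes C)$ with $\otimes\in\{\to,\times,+\}$ is a cross cast and $A=A_1\otimes A_2$ for some $A_1,A_2$; no cast into a base type is inert; and operations taking a cast $c$ and a proof $x$ of $\mathsf{Cross}\,c$: for $c:(A_1\to A_2)\Rightarrow(B_1\to B_2)$, $\mathsf{dom}\,c\,x:B_1\Rightarrow A_1$ and $\mathsf{cod}\,c\,x:A_2\Rightarrow B_2$; for $c:(A_1\times A_2)\Rightarrow(B_1\times B_2)$, $\mathsf{fst}\,c\,x:A_1\Rightarrow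 B_1$ and $\mathsf{snd}\,c\,x:A_2\Rightarrow B_2$; for $c:(A_1+A_2)\Rightarrow(B_1+B_2)$, $\mathsf{inl}\,c\,x:A_1\Rightarrow B_1$ and $\mathsf{inr}\,c\,x:A_2\Rightarrow B_2$. A **ComposableCasts** structure adds: for each simple value $S:\Gamma\vdash A$, $c:A\Rightarrow B$, $a:\mathsf{Active}\,c$, a term $\mathsf{applyCast}\,S\,c\,a:\Gamma\vdash B$; and a composition operation sending $c:A\Rightarrow B$, $d:B\Rightarrow C$ to $c\ast d:A\Rightarrow C$. **Terms** of $SC(\Rightarrow)$ ($M:\Gamma\vdash A$): $\$k:P$ for $k\in[\![P]\!]$; $`x:A$ if $x$ has type $A$ in $\Gamma$; $\lambda M:A\to B$ if $M:\Gamma\cdot A\vdash B$; $L\,M:B$ if $L:A\to B$, $M:A$; $\mathtt{if}\,L\,M\,N:B$ if $L:\mathtt{Bool}$, $M,N:B$; $\mathtt{cons}\,M\,N:A\times B$; $\pi_iM:A_i$ if $M:A_1\times A_2$; $\mathtt{inl}[B]M:A+B$ if $M:A$; $\mathtt{inr}[A]M:A+B$ if $M:B$; $\mathtt{case}\,L\,M\,N:B$ if $L:A_1+A_2$, $M:A_1\to B$, $N:A_2\to B$; $M\langle c\rangle:B$ if $M:A$, $c:A\Rightarrow B$; $\mathtt{blame}\,\ell:A$ for every $A$. **Simple values** $S$: $\lambda M$; $\$k$; $\mathtt{cons}\,V\,W$; $\mathtt{inl}[B]V$; $\mathtt{inr}[A]V$. **Values** $V,W$: $S$; $S\langle c\rangle$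 with $c$ inert. **Frames** $F$ (none for casts): $\Box\,M$; $V\,\Box$; $\mathtt{if}\,\Box\,M\,N$; $\mathtt{cons}\,V\,\Box$; $\mathtt{cons}\,\Box\,N$; $\pi_i\Box$; $\mathtt{inl}[B]\Box$; $\mathtt{inr}[A]\Box$; $\mathtt{case}\,\Box\,M\,N$. **Reduction** $ctx\vdash M\longrightarrow N$, $ctx\in\{\mathtt{Any},\mathtt{NonCast}\}$ ($M[V]$ substitution for variable $0$; $\uparrow$ weakening; blame taken at the required type): - $\mathtt{Any}\vdash F[M]\longrightarrow F[M']$ if $ctx\vdash M\longrightarrow M'$ for some $ctx$; $\mathtt{NonCast}\vdash M\langle c\rangle\longrightarrow M'\langle c\rangle$ if $\mathtt{Any}\vdash M\longrightarrow M'$. - $\mathtt{Any}\vdash F[\mathtt{blame}\,\ell]\longrightarrow\mathtt{blame}\,\ell$; $\mathtt{NonCast}\vdash(\mathtt{blame}\,\ell)\langle c\rangle\longrightarrow\mathtt{blame}\,\ell$. - $\mathtt{NonCast}\vdash S\langle c\rangle\longrightarrow\mathsf{applyCast}\,S\,c\,a$ for $a:\mathsf{Active}\,c$; $\mathtt{NonCast}\vdash M\langle c\rangle\langle d\rangle\longrightarrow M\langle c\ast d\rangle$. - With $ctx=\mathtt{Any}$, for $x:\mathsf{Cross}\,c$: $V\langle c\rangle\,W\longrightarrow(V\,(W\langle\mathsf{dom}\,c\,x\rangle))\langle\mathsf{cod}\,c\,x\rangle$; $\pi_1(V\langle c\rangle)\longrightarrow(\pi_1V)\langle\mathsf{fst}\,c\,x\rangle$;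 $\pi_2(V\langle c\rangle)\longrightarrow(\pi_2V)\langle\mathsf{snd}\,c\,x\rangle$; $\mathtt{case}\,(V\langle c\rangle)\,M\,N\longrightarrow\mathtt{case}\,V\,(\lambda((\uparrow M)\,(`0\langle\mathsf{inl}\,c\,x\rangle)))\,(\lambda((\uparrow N)\,(`0\langle\mathsf{inr}\,c\,x\rangle)))$. - With $ctx=\mathtt{Any}$: $(\lambda M)V\longrightarrow M[V]$; $\mathtt{if}\,\$\mathtt{true}\,M\,N\longrightarrow M$; $\mathtt{if}\,\$\mathtt{false}\,M\,N\longrightarrow N$; $\pi_1(\mathtt{cons}\,V\,W)\longrightarrow V$; $\pi_2(\mathtt{cons}\,V\,W)\longrightarrow W$; $\mathtt{case}(\mathtt{inl}[B]V)\,L\,M\longrightarrow L\,V$; $\mathtt{case}(\mathtt{inr}[A]V)\,L\,M\longrightarrow M\,V$; $\$k\,\$k'\longrightarrow\$(k(k'))$. *)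

theory Defs
  imports "HOL-Library.FuncSet"
begin

section \<open>Types and constants\<close>

datatype base = TNat | TBool | TInt | TUnit | TBot

datatype ty =
    Base base
  | Unknown
  | Fun ty ty
  | Prod ty ty
  | Sum ty ty

datatype prim = PBase base | PFun base prim

primrec prim_ty :: "prim \<Rightarrow> ty" where
  "prim_ty (PBase b) = Base b"
| "prim_ty (PFun b P) = Fun (Base b) (prim_ty P)"

datatype base_val = VNat nat | VBool bool | VInt int | VUnit

primrec base_den :: "base \<Rightarrow> base_val set" where
  "base_den TNat = range VNat"
| "base_den TBool = range VBool"
| "base_den TInt = range VInt"
| "base_den TUnit = {VUnit}"
| "base_den TBot = {}"

datatype const_val = KBase base_val | KFun "base_val \<Rightarrow> const_val"

text \<open>
  The extensional function space makes \<open>prim_den (PFun b P)\<close> correspond bijectively to the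
  functions from \<open>base_den b\<close> to \<open>prim_den P\<close>: values outside the domain are not counted.
\<close>

primrec prim_den :: "prim \<Rightarrow> const_val set" where
  "prim_den (PBase b) = KBase ` base_den b"
| "prim_den (PFun b P) = KFun ` (base_den b \<rightarrow>\<^sub>E prim_den P)"

section \<open>Raw terms\<close>

text \<open>
  Terms are raw terms over casts \<open>'c\<close> and blame labels \<open>'l\<close>; typing is a separate judgement.
  A context is a list of types whose head is the last type added, so that de Bruijn index
  \<open>i\<close> refers to position \<open>i\<close>. The branches of \<open>Case\<close> are function-typed terms, not binders.
\<close>

type_synonym ctxt = "ty list"

datatype ('c, 'l) tm =
    Const const_val
  | Var nat
  | Lam "('c, 'l) tm"
  | App "('c, 'l) tm" "('c, 'l) tm"
  | Ite "('c, 'l) tm" "('c, 'l) tm" "('c, 'l) tm"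
  | MkPair "('c, 'l) tm" "('c, 'l) tm"
  | Proj1 "('c, 'l) tm"
  | Proj2 "('c, 'l) tm"
  | InL ty "('c, 'l) tm"
  | InR ty "('c, 'l) tm"
  | Case "('c, 'l) tm" "('c, 'l) tm" "('c, 'l) tm"
  | Cast "('c, 'l) tm" 'c
  | Blame 'l

primrec shift :: "nat \<Rightarrow> ('c, 'l) tm \<Rightarrow> ('c, 'l) tm" where
  "shift n (Const k) = Const k"
| "shift n (Var i) = Var (if i < n then i else Suc i)"
| "shift n (Lam M) = Lam (shift (Suc n) M)"
| "shift n (App L M) = App (shift n L) (shift n M)"
| "shift n (Ite L M N) = Ite (shift n L) (shift n M) (shift n N)"
| "shift n (MkPair M N) = MkPair (shift n M) (shift n N)"
| "shift n (Proj1 M) = Proj1 (shift n M)"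
| "shift n (Proj2 M) = Proj2 (shift n M)"
| "shift n (InL B M) = InL B (shift n M)"
| "shift n (InR A M) = InR A (shift n M)"
| "shift n (Case L M N) = Case (shift n L) (shift n M) (shift n N)"
| "shift n (Cast M c) = Cast (shift n M) c"
| "shift n (Blame l) = Blame l"

abbreviation weaken :: "('c, 'l) tm \<Rightarrow> ('c, 'l) tm" where
  "weaken \<equiv> shift 0"

text \<open>\<open>subst n V M\<close> replaces variable \<open>n\<close> by \<open>V\<close> and lowers the variables above \<open>n\<close> by one.\<close>

primrec subst :: "nat \<Rightarrow> ('c, 'l) tm \<Rightarrow> ('c, 'l) tm \<Rightarrow> ('c, 'l) tm" where
  "subst n V (Const k) = Const k"
| "subst n V (Var i) = (if i < n then Var i else if i = n then V else Var (i - 1))"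
| "subst n V (Lam M) = Lam (subst (Suc n) (weaken V) M)"
| "subst n V (App L M) = App (subst n V L) (subst n V M)"
| "subst n V (Ite L M N) = Ite (subst n V L) (subst n V M) (subst n V N)"
| "subst n V (MkPair M N) = MkPair (subst n V M) (subst n V N)"
| "subst n V (Proj1 M) = Proj1 (subst n V M)"
| "subst n V (Proj2 M) = Proj2 (subst n V M)"
| "subst n V (InL B M) = InL B (subst n V M)"
| "subst n V (InR A M) = InR A (subst n V M)"
| "subst n V (Case L M N) = Case (subst n V L) (subst n V M) (subst n V N)"
| "subst n V (Cast M c) = Cast (subst n V M) c"
| "subst n V (Blame l) = Blame l"

section \<open>Cast structures\<close>

text \<open>
  The family of sets of casts, indexed by source and target type, is given by its disjoint
  union \<open>casts\<close> together with the two index maps \<open>src\<close> and \<open>tgt\<close>; \<open>cast_set P A B\<close> is the set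
  of casts from \<open>A\<close> to \<open>B\<close>. Operations that take a proof of a predicate on casts are total
  functions without the proof argument; they are constrained only where the predicate holds.
\<close>

record 'c pre_cast_struct =
  casts :: "'c set"
  src :: "'c \<Rightarrow> ty"
  tgt :: "'c \<Rightarrow> ty"
  inert :: "'c \<Rightarrow> bool"
  active :: "'c \<Rightarrow> bool"
  cross :: "'c \<Rightarrow> bool"
  dom_cast :: "'c \<Rightarrow> 'c"
  cod_cast :: "'c \<Rightarrow> 'c"
  fst_cast :: "'c \<Rightarrow> 'c"
  snd_cast :: "'c \<Rightarrow> 'c"
  inl_cast :: "'c \<Rightarrow> 'c"
  inr_cast :: "'c \<Rightarrow> 'c"

definition cast_set :: "('c, 'm) pre_cast_struct_scheme \<Rightarrow> ty \<Rightarrow> ty \<Rightarrow> 'c set" where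
  "cast_set P A B = {c \<in> casts P. src P c = A \<and> tgt P c = B}"

locale pre_cast_struct =
  fixes P :: "('c, 'm) pre_cast_struct_scheme" (structure)
  assumes active_or_inert: "c \<in> casts P \<Longrightarrow> active P c \<or> inert P c"
    and inert_Fun: "\<lbrakk>c \<in> cast_set P A (Fun B C); inert P c\<rbrakk>
      \<Longrightarrow> cross P c \<and> (\<exists>A\<^sub>1 A\<^sub>2. A = Fun A\<^sub>1 A\<^sub>2)"
    and inert_Prod: "\<lbrakk>c \<in> cast_set P A (Prod B C); inert P c\<rbrakk>
      \<Longrightarrow> cross P c \<and> (\<exists>A\<^sub>1 A\<^sub>2. A = Prod A\<^sub>1 A\<^sub>2)"
    and inert_Sum: "\<lbrakk>c \<in> cast_set P A (Sum B C); inert P c\<rbrakk>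
      \<Longrightarrow> cross P c \<and> (\<exists>A\<^sub>1 A\<^sub>2. A = Sum A\<^sub>1 A\<^sub>2)"
    and not_inert_Base: "c \<in> cast_set P A (Base b) \<Longrightarrow> \<not> inert P c"
    and dom_cast: "\<lbrakk>c \<in> cast_set P (Fun A\<^sub>1 A\<^sub>2) (Fun B\<^sub>1 B\<^sub>2); cross P c\<rbrakk>
      \<Longrightarrow> dom_cast P c \<in> cast_set P B\<^sub>1 A\<^sub>1"
    and cod_cast: "\<lbrakk>c \<in> cast_set P (Fun A\<^sub>1 A\<^sub>2) (Fun B\<^sub>1 B\<^sub>2); cross P c\<rbrakk>
      \<Longrightarrow> cod_cast P c \<in> cast_set P A\<^sub>2 B\<^sub>2"
    and fst_cast: "\<lbrakk>c \<in> cast_set P (Prod A\<^sub>1 A\<^sub>2) (Prod B\<^sub>1 B\<^sub>2); cross P c\<rbrakk>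
      \<Longrightarrow> fst_cast P c \<in> cast_set P A\<^sub>1 B\<^sub>1"
    and snd_cast: "\<lbrakk>c \<in> cast_set P (Prod A\<^sub>1 A\<^sub>2) (Prod B\<^sub>1 B\<^sub>2); cross P c\<rbrakk>
      \<Longrightarrow> snd_cast P c \<in> cast_set P A\<^sub>2 B\<^sub>2"
    and inl_cast: "\<lbrakk>c \<in> cast_set P (Sum A\<^sub>1 A\<^sub>2) (Sum B\<^sub>1 B\<^sub>2); cross P c\<rbrakk>
      \<Longrightarrow> inl_cast P c \<in> cast_set P A\<^sub>1 B\<^sub>1"
    and inr_cast: "\<lbrakk>c \<in> cast_set P (Sum A\<^sub>1 A\<^sub>2) (Sum B\<^sub>1 B\<^sub>2); cross P c\<rbrakk>
      \<Longrightarrow> inr_cast P c \<in> cast_set P A\<^sub>2 B\<^sub>2"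

section \<open>Typing and values\<close>

inductive typed :: "('c, 'm) pre_cast_struct_scheme \<Rightarrow> ctxt \<Rightarrow> ('c, 'l) tm \<Rightarrow> ty \<Rightarrow> bool"
  for P where
  Const: "k \<in> prim_den T \<Longrightarrow> typed P \<Gamma> (Const k) (prim_ty T)"
| Var: "\<lbrakk>i < length \<Gamma>; \<Gamma> ! i = A\<rbrakk> \<Longrightarrow> typed P \<Gamma> (Var i) A"
| Lam: "typed P (A # \<Gamma>) M B \<Longrightarrow> typed P \<Gamma> (Lam M) (Fun A B)"
| App: "\<lbrakk>typed P \<Gamma> L (Fun A B); typed P \<Gamma> M A\<rbrakk> \<Longrightarrow> typed P \<Gamma> (App L M) B"
| Ite: "\<lbrakk>typed P \<Gamma> L (Base TBool); typed P \<Gamma> M B; typed P \<Gamma> N B\<rbrakk>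
    \<Longrightarrow> typed P \<Gamma> (Ite L M N) B"
| MkPair: "\<lbrakk>typed P \<Gamma> M A; typed P \<Gamma> N B\<rbrakk> \<Longrightarrow> typed P \<Gamma> (MkPair M N) (Prod A B)"
| Proj1: "typed P \<Gamma> M (Prod A\<^sub>1 A\<^sub>2) \<Longrightarrow> typed P \<Gamma> (Proj1 M) A\<^sub>1"
| Proj2: "typed P \<Gamma> M (Prod A\<^sub>1 A\<^sub>2) \<Longrightarrow> typed P \<Gamma> (Proj2 M) A\<^sub>2"
| InL: "typed P \<Gamma> M A \<Longrightarrow> typed P \<Gamma> (InL B M) (Sum A B)"
| InR: "typed P \<Gamma> M B \<Longrightarrow> typed P \<Gamma> (InR A M) (Sum A B)"
| Case: "\<lbrakk>typed P \<Gamma> L (Sum A\<^sub>1 A\<^sub>2); typed P \<Gamma> M (Fun A\<^sub>1 B); typed P \<Gamma> N (Fun A\<^sub>2 B)\<rbrakk>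
    \<Longrightarrow> typed P \<Gamma> (Case L M N) B"
| Cast: "\<lbrakk>typed P \<Gamma> M A; c \<in> cast_set P A B\<rbrakk> \<Longrightarrow> typed P \<Gamma> (Cast M c) B"
| Blame: "typed P \<Gamma> (Blame l) A"

inductive simple_value :: "('c, 'm) pre_cast_struct_scheme \<Rightarrow> ('c, 'l) tm \<Rightarrow> bool"
  and is_value :: "('c, 'm) pre_cast_struct_scheme \<Rightarrow> ('c, 'l) tm \<Rightarrow> bool"
  for P where
  "simple_value P (Lam M)"
| "simple_value P (Const k)"
| "\<lbrakk>is_value P V; is_value P W\<rbrakk> \<Longrightarrow> simple_value P (MkPair V W)"
| "is_value P V \<Longrightarrow> simple_value P (InL B V)"
| "is_value P V \<Longrightarrow> simple_value P (InR A V)"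
| "simple_value P S \<Longrightarrow> is_value P S"
| "\<lbrakk>simple_value P S; inert P c\<rbrakk> \<Longrightarrow> is_value P (Cast S c)"

section \<open>Composable casts\<close>

text \<open>
  \<open>apply_cast\<close> takes the context of its simple value, so its result may depend on that context.
\<close>

record ('c, 'l) composable_casts = "'c pre_cast_struct" +
  apply_cast :: "ctxt \<Rightarrow> ('c, 'l) tm \<Rightarrow> 'c \<Rightarrow> ('c, 'l) tm"
  compose :: "'c \<Rightarrow> 'c \<Rightarrow> 'c"

locale composable_casts = pre_cast_struct P
  for P :: "('c, 'l, 'm) composable_casts_scheme" (structure) +
  assumes apply_cast: "\<lbrakk>simple_value P S; typed P \<Gamma> S A; c \<in> cast_set P A B; active P c\<rbrakk>
      \<Longrightarrow> typed P \<Gamma> (apply_cast P \<Gamma> S c) B"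
    and compose: "\<lbrakk>c \<in> cast_set P A B; d \<in> cast_set P B C\<rbrakk>
      \<Longrightarrow> compose P c d \<in> cast_set P A C"

section \<open>Frames and reduction\<close>

datatype ('c, 'l) frame =
    FAppL "('c, 'l) tm"
  | FAppR "('c, 'l) tm"
  | FIte "('c, 'l) tm" "('c, 'l) tm"
  | FPairR "('c, 'l) tm"
  | FPairL "('c, 'l) tm"
  | FProj1
  | FProj2
  | FInL ty
  | FInR ty
  | FCase "('c, 'l) tm" "('c, 'l) tm"

primrec plug :: "('c, 'l) frame \<Rightarrow> ('c, 'l) tm \<Rightarrow> ('c, 'l) tm" where
  "plug (FAppL M) X = App X M"
| "plug (FAppR V) X = App V X"
| "plug (FIte M N) X = Ite X M N"
| "plug (FPairR V) X = MkPair V X"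
| "plug (FPairL N) X = MkPair X N"
| "plug FProj1 X = Proj1 X"
| "plug FProj2 X = Proj2 X"
| "plug (FInL B) X = InL B X"
| "plug (FInR A) X = InR A X"
| "plug (FCase M N) X = Case X M N"

text \<open>Evaluation is left to right: the term to the left of the hole must be a value.\<close>

primrec is_frame :: "('c, 'm) pre_cast_struct_scheme \<Rightarrow> ('c, 'l) frame \<Rightarrow> bool" where
  "is_frame P (FAppL M) = True"
| "is_frame P (FAppR V) = is_value P V"
| "is_frame P (FIte M N) = True"
| "is_frame P (FPairR V) = is_value P V"
| "is_frame P (FPairL N) = True"
| "is_frame P FProj1 = True"
| "is_frame P FProj2 = True"
| "is_frame P (FInL B) = True"
| "is_frame P (FInR A) = True"
| "is_frame P (FCase M N) = True"

datatype red_ctx = Any | NonCast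

text \<open>
  Reduction is between terms in a context \<open>\<Gamma>\<close>, which is only used by \<open>apply_cast\<close>. It never goes
  under a binder, so \<open>\<Gamma>\<close> is fixed. Since \<open>Blame l\<close> has every type, the blame rules need no type.
  The rules that decompose a cross cast state the shape of its source and target because
  \<open>dom_cast\<close> etc. are only meaningful for that shape, and \<open>cross\<close> alone does not imply it.
\<close>

inductive reduces ::
  "('c, 'l, 'm) composable_casts_scheme \<Rightarrow> ctxt \<Rightarrow> red_ctx \<Rightarrow> ('c, 'l) tm \<Rightarrow> ('c, 'l) tm \<Rightarrow> bool"
  for P \<Gamma> where
  frame: "\<lbrakk>is_frame P F; reduces P \<Gamma> ctx M M'\<rbrakk> \<Longrightarrow> reduces P \<Gamma> Any (plug F M) (plug F M')"
| cast: "reduces P \<Gamma> Any M M' \<Longrightarrow> reduces P \<Gamma> NonCast (Cast M c) (Cast M' c)"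
| frame_blame: "is_frame P F \<Longrightarrow> reduces P \<Gamma> Any (plug F (Blame l)) (Blame l)"
| cast_blame: "reduces P \<Gamma> NonCast (Cast (Blame l) c) (Blame l)"
| apply_cast: "\<lbrakk>simple_value P S; active P c\<rbrakk>
    \<Longrightarrow> reduces P \<Gamma> NonCast (Cast S c) (apply_cast P \<Gamma> S c)"
| compose: "reduces P \<Gamma> NonCast (Cast (Cast M c) d) (Cast M (compose P c d))"
| fun_cast: "\<lbrakk>is_value P V; is_value P W; c \<in> cast_set P (Fun A\<^sub>1 A\<^sub>2) (Fun B\<^sub>1 B\<^sub>2); cross P c\<rbrakk>
    \<Longrightarrow> reduces P \<Gamma> Any (App (Cast V c) W)
          (Cast (App V (Cast W (dom_cast P c))) (cod_cast P c))"
| fst_cast: "\<lbrakk>is_value P V; c \<in> cast_set P (Prod A\<^sub>1 A\<^sub>2) (Prod B\<^sub>1 B\<^sub>2); cross P c\<rbrakk>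
    \<Longrightarrow> reduces P \<Gamma> Any (Proj1 (Cast V c)) (Cast (Proj1 V) (fst_cast P c))"
| snd_cast: "\<lbrakk>is_value P V; c \<in> cast_set P (Prod A\<^sub>1 A\<^sub>2) (Prod B\<^sub>1 B\<^sub>2); cross P c\<rbrakk>
    \<Longrightarrow> reduces P \<Gamma> Any (Proj2 (Cast V c)) (Cast (Proj2 V) (snd_cast P c))"
| case_cast: "\<lbrakk>is_value P V; c \<in> cast_set P (Sum A\<^sub>1 A\<^sub>2) (Sum B\<^sub>1 B\<^sub>2); cross P c\<rbrakk>
    \<Longrightarrow> reduces P \<Gamma> Any (Case (Cast V c) M N)
          (Case V (Lam (App (weaken M) (Cast (Var 0) (inl_cast P c))))
                  (Lam (App (weaken N) (Cast (Var 0) (inr_cast P c)))))"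
| beta: "is_value P V \<Longrightarrow> reduces P \<Gamma> Any (App (Lam M) V) (subst 0 V M)"
| if_true: "reduces P \<Gamma> Any (Ite (Const (KBase (VBool True))) M N) M"
| if_false: "reduces P \<Gamma> Any (Ite (Const (KBase (VBool False))) M N) N"
| proj1: "\<lbrakk>is_value P V; is_value P W\<rbrakk> \<Longrightarrow> reduces P \<Gamma> Any (Proj1 (MkPair V W)) V"
| proj2: "\<lbrakk>is_value P V; is_value P W\<rbrakk> \<Longrightarrow> reduces P \<Gamma> Any (Proj2 (MkPair V W)) W"
| case_inl: "is_value P V \<Longrightarrow> reduces P \<Gamma> Any (Case (InL B V) L M) (App L V)"
| case_inr: "is_value P V \<Longrightarrow> reduces P \<Gamma> Any (Case (InR A V) L M) (App M V)"
| delta: "reduces P \<Gamma> Any (App (Const (KFun f)) (Const (KBase v))) (Const (f v))"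

end

theory Submission
  imports Defs
begin

text \<open>Induction on the reduction: inverting the typing of the redex yields the types of its
  parts, from which the contractum is rebuilt. Congruence rules need that a hole can be refilled at
  its own type (\<open>typed_plug\<close>), beta needs substitution (\<open>typed_beta\<close>),
  constant application needs the denotations of primitive types (\<open>typed_delta\<close>), and
  the cast rules need the typing laws of the cast structure. Blame has every type.\<close>

inductive_cases typed_ConstE: "typed P \<Gamma> (Const k) A"
inductive_cases typed_Lam_FunE: "typed P \<Gamma> (Lam M) (Fun A B)"
inductive_cases typed_AppE: "typed P \<Gamma> (App L M) A"
inductive_cases typed_IteE: "typed P \<Gamma> (Ite L M N) A"
inductive_cases typed_MkPairE: "typed P \<Gamma> (MkPair M N) A"
inductive_cases typed_Proj1E: "typed P \<Gamma> (Proj1 M) A"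
inductive_cases typed_Proj2E: "typed P \<Gamma> (Proj2 M) A"
inductive_cases typed_InLE: "typed P \<Gamma> (InL B M) A"
inductive_cases typed_InRE: "typed P \<Gamma> (InR B M) A"
inductive_cases typed_CaseE: "typed P \<Gamma> (Case L M N) A"
inductive_cases typed_CastE: "typed P \<Gamma> (Cast M c) A"

text \<open>The prefix \<open>\<Delta>\<close> stands for the binders already crossed; without it
  the induction would fail at \<open>Lam\<close>.\<close>

lemma typed_shift:
  "typed P (\<Delta> @ \<Gamma>) M A \<Longrightarrow> typed P (\<Delta> @ B # \<Gamma>) (shift (length \<Delta>) M) A"
proof (induction "\<Delta> @ \<Gamma>" M A arbitrary: \<Delta> rule: typed.induct)
  case (Var i A)
  then show ?case by (auto intro!: typed.Var simp: nth_append Suc_diff_le)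
next
  case (Lam A M B)
  from Lam(2)[of "A # \<Delta>"] show ?case by (auto intro: typed.Lam)
qed (auto intro: typed.intros)

lemma typed_weaken: "typed P \<Gamma> M A \<Longrightarrow> typed P (B # \<Gamma>) (weaken M) A"
  using typed_shift[of P "[]"] by simp

lemma typed_subst:
  "\<lbrakk>typed P (\<Delta> @ B # \<Gamma>) M A; typed P (\<Delta> @ \<Gamma>) V B\<rbrakk>
    \<Longrightarrow> typed P (\<Delta> @ \<Gamma>) (subst (length \<Delta>) V M) A"
\<comment> \<open>\<open>V\<close> must vary along with \<open>\<Delta>\<close>, since substitution
  weakens it under each binder.\<close>
proof (induction "\<Delta> @ B # \<Gamma>" M A arbitrary: \<Delta> V rule: typed.induct)
  case (Var i A)
  then show ?case by (auto intro!: typed.Var simp: nth_append nth_Cons')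
next
  case (Lam A M C)
  from Lam(2)[of "A # \<Delta>"] Lam(3) show ?case by (auto intro: typed.Lam typed_weaken)
qed (auto intro: typed.intros)

lemma typed_beta:
  "\<lbrakk>typed P (B # \<Gamma>) M A; typed P \<Gamma> V B\<rbrakk> \<Longrightarrow> typed P \<Gamma> (subst 0 V M) A"
  using typed_subst[of P "[]"] by simp

text \<open>A constant may inhabit several primitive types, so the argument works with whichever
  ones the derivation chose: the function type forces a base domain \<open>b\<close>, and membership
  in the function space then places \<open>f v\<close>.\<close>

lemma typed_delta:
  fixes P :: "('c, 'm) pre_cast_struct_scheme"
  assumes "typed P \<Gamma> (App (Const (KFun f)) (Const (KBase v)) :: ('c, 'l) tm) A"
  shows "typed P \<Gamma> (Const (f v) :: ('c, 'l) tm) A"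
proof -
  from assms obtain B where "typed P \<Gamma> (Const (KFun f) :: ('c, 'l) tm) (Fun B A)"
    and "typed P \<Gamma> (Const (KBase v) :: ('c, 'l) tm) B"
    by (blast elim: typed_AppE)
  then obtain T U where T: "KFun f \<in> prim_den T" "prim_ty T = Fun B A"
    and U: "KBase v \<in> prim_den U" "prim_ty U = B"
    by (auto elim!: typed_ConstE)
  from T obtain b T' where "B = Base b" "A = prim_ty T'" "f \<in> base_den b \<rightarrow>\<^sub>E prim_den T'"
    by (cases T) auto
  moreover from U \<open>B = Base b\<close> have "v \<in> base_den b"
    by (cases U) auto
  ultimately show ?thesis
    by (auto intro: typed.Const)
qed

text \<open>The typing of a plugged frame uses its hole only through some type \<open>B\<close>, so
  any term of that type can be swapped in.\<close>

lemma typed_plug: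
  assumes "typed P \<Gamma> (plug F M) A"
  obtains B where "typed P \<Gamma> M B"
    and "\<And>N. typed P \<Gamma> N B \<Longrightarrow> typed P \<Gamma> (plug F N) A"
  using assms
  by (cases F)
    (auto elim!: typed_AppE typed_IteE typed_MkPairE typed_Proj1E typed_Proj2E
      typed_InLE typed_InRE typed_CaseE intro: typed.intros)

text \<open>Identifies the types found by inverting a cast's typing with the shape demanded by a
  cross-cast rule.\<close>

lemma cast_set_unique:
  "\<lbrakk>c \<in> cast_set P A B; c \<in> cast_set P A' B'\<rbrakk> \<Longrightarrow> A = A' \<and> B = B'"
  by (simp add: cast_set_def)

theorem theorem114:
  fixes P :: "('c, 'l, 'm) composable_casts_scheme"
    and \<Gamma> :: ctxt and A :: ty and M M' :: "('c, 'l) tm" and ctx :: red_ctx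
  assumes "composable_casts P"
    and "typed P \<Gamma> M A"
    and "reduces P \<Gamma> ctx M M'"
  shows "typed P \<Gamma> M' A"
proof -
  interpret S: composable_casts P by fact
  from assms(3,2) show ?thesis
  \<comment> \<open>The type varies because a reducing subterm need not have the type of the whole
    term; the context stays fixed since reduction never enters a binder.\<close>
  proof (induction arbitrary: A rule: reduces.induct)
    case (frame F ctx M M')
    then show ?case by (blast elim: typed_plug)
  next
    case (cast M M' c)
    then show ?case by (blast elim: typed_CastE intro: typed.Cast)
  next
    case (apply_cast S c)
    then obtain B where "typed P \<Gamma> S B" "c \<in> cast_set P B A"
      by (blast elim: typed_CastE)
    with apply_cast.hyps show ?case
      by (blast intro: S.apply_cast)
  next
    case (compose M c d)
    then show ?case by (blast elim: typed_CastE intro: typed.Cast S.compose)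
  next
    case (fun_cast V W c A\<^sub>1 A\<^sub>2 B\<^sub>1 B\<^sub>2)
    then have "typed P \<Gamma> V (Fun A\<^sub>1 A\<^sub>2)" "typed P \<Gamma> W B\<^sub>1" "A = B\<^sub>2"
      by (auto elim!: typed_AppE typed_CastE dest: cast_set_unique)
    with fun_cast show ?case
      by (blast intro: typed.Cast typed.App S.dom_cast S.cod_cast)
  next
    case (fst_cast V c A\<^sub>1 A\<^sub>2 B\<^sub>1 B\<^sub>2)
    then have "typed P \<Gamma> V (Prod A\<^sub>1 A\<^sub>2)" "A = B\<^sub>1"
      by (auto elim!: typed_Proj1E typed_CastE dest: cast_set_unique)
    with fst_cast show ?case
      by (blast intro: typed.Cast typed.Proj1 S.fst_cast)
  next
    case (snd_cast V c A\<^sub>1 A\<^sub>2 B\<^sub>1 B\<^sub>2)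
    then have "typed P \<Gamma> V (Prod A\<^sub>1 A\<^sub>2)" "A = B\<^sub>2"
      by (auto elim!: typed_Proj2E typed_CastE dest: cast_set_unique)
    with snd_cast show ?case
      by (blast intro: typed.Cast typed.Proj2 S.snd_cast)
  next
    case (case_cast V c A\<^sub>1 A\<^sub>2 B\<^sub>1 B\<^sub>2 M N)
    then have V: "typed P \<Gamma> V (Sum A\<^sub>1 A\<^sub>2)"
      and M: "typed P \<Gamma> M (Fun B\<^sub>1 A)" and N: "typed P \<Gamma> N (Fun B\<^sub>2 A)"
      by (auto elim!: typed_CaseE typed_CastE dest: cast_set_unique)
    \<comment> \<open>The new branch coerces its bound variable from the uncast component type
      \<open>C\<close> to the type \<open>D\<close> that the old branch expects.\<close>
    have branch: "typed P \<Gamma> (Lam (App (weaken L) (Cast (Var 0) d))) (Fun C A)"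
      if "typed P \<Gamma> L (Fun D A)" "d \<in> cast_set P C D" for L C D d
      using that by (auto intro!: typed.Lam typed.App typed.Cast typed.Var typed_weaken)
    from case_cast(2,3) V M N show ?case
      by (blast intro: typed.Case branch S.inl_cast S.inr_cast)
  next
    case (beta V M)
    then show ?case by (blast elim: typed_AppE typed_Lam_FunE intro: typed_beta)
  next
    case (delta f v)
    then show ?case by (rule typed_delta)
  qed (auto elim!: typed_IteE typed_Proj1E typed_Proj2E typed_MkPairE typed_CaseE typed_InLE
      typed_InRE intro: typed.App typed.Blame)
qed

end
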